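(* Let $n\ge2$, $p\ge1$, let $\mathcal G$ be a connected weighted undirected graph on $[n]$ with Laplacian matrix $L=(L_{ij})$, and let $f_i:\mathbb{R}^p\to\mathbb{R}$, $i\in[n]$, be differentiable functions. Put $f(x)=\sum_{i=1}^n f_i(x)$ for $x\in\mathbb{R}^p$ and $\tilde f(\boldsymbol{x})=\sum_{i=1}^n f_i(x_i)$ for $\boldsymbol{x}=\mathrm{col}(x_1,\dots,x_n)\in\mathbb{R}^{np}$. Let $X^*$ be the set of global minimizers of $f$ over $\mathbb{R}^p$ and $\boldsymbol{X}^*=\{\mathbf{1}_n\otimes x^*:x^*\in X^*\}$. Assume: (i) $X^*$ is nonempty and convex; (ii) for each $i\in[n]$ there is $L_{f_i}>0$ with $\|\nabla f_i(a)-\nabla f_i(b)\|\le L_{f_i}\|a-b\|$ for all $a,b\in\mathbb{R}^p$; let $L_f=\max_{i\in[n]}L_{f_i}$; (iii) $f$ satisfies the restricted secant inequality condition with constant $\nu>0$; (iv) the set $\{\nabla\tilde f(\boldsymbol{x}):\boldsymbol{x}\in\boldsymbol{X}^*\}$ is a singleton. Let $\alpha>\frac{2nL_f^2+\nu L_f}{\nu\rho_2(L)}$ and $\beta>0$, and let $x_i(t),v_i(t)\in\mathbb{R}^p$, $i\in[n]$, $t\ge0$, be a solution of $$\dot x_i(t)=-\alpha\sum_{j=1}^nL_{ij}x_j(t)-\beta v_i(t)-\nabla f_i(x_i(t)),\qquad \dot v_i(t)=\beta\sum_{j=1}^nL_{ij}x_j(t),$$ with arbitrary $x_i(0)\in\mathbb{R}^p$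 and $v_i(0)=\mathbf{0}_p$. Then $\boldsymbol{x}(t)=\mathrm{col}(x_1(t),\dots,x_n(t))$ converges exponentially to $\boldsymbol{X}^*$ with a rate no less than $\frac{\epsilon_2}{2\epsilon_3}>0$, i.e., there is a constant $C\ge0$ (depending on the initial condition) such that $$\|\boldsymbol{x}(t)-\mathcal{P}_{\boldsymbol{X}^*}(\boldsymbol{x}(t))\|\le C\,e^{-\frac{\epsilon_2}{2\epsilon_3}t}\quad\text{for all }t\ge0,$$ where $$\nu_1=\min\Big\{\frac{\nu}{2n},\ \alpha\rho_2(L)-\frac{2nL_f^2+\nu L_f}{\nu}\Big\},\qquad \epsilon_1=\max\Big\{\frac1{\nu_1}\Big(\frac{L_f^2}{2\beta}+\rho(L)\beta\Big),\ \frac{\beta}{\alpha}\Big\},$$ $$\epsilon_2=\min\Big\{\frac{\beta}{2},\ \epsilon_1\nu_1\Big\}>0,\qquad \epsilon_3=\max\Big\{\frac{\epsilon_1}{\rho_2(L)}+\frac{\alpha}{2\beta}+\frac12,\ \epsilon_1+\frac12\Big\}.$$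
   Context: $[n]=\{1,\dots,n\}$; $\mathrm{col}(x_1,\dots,x_n)$ is the concatenated column vector; $\mathbf{1}_n$ is the all-ones vector in $\mathbb{R}^n$ and $\mathbf{0}_p$ the zero vector in $\mathbb{R}^p$; $\otimes$ is the Kronecker product; $\|\cdot\|$ is the Euclidean norm. Graph: a weighted undirected graph on $[n]$ is given by a symmetric weighted adjacency matrix $A=(a_{ij})$ with $a_{ij}\ge 0$ and $a_{ii}=0$; $i$ and $j$ are joined by an edge iff $a_{ij}>0$. The graph is connected if there is a path between any two vertices. Its Laplacian is $L=\mathrm{diag}(\deg_1,\dots,\deg_n)-A$ with $\deg_i=\sum_{j=1}^n a_{ij}$. $\rho(L)$ denotes the spectral radius of $L$ and $\rho_2(L)$ its smallest positive eigenvalue. Projection: for a nonempty closed convex set $S$, $\mathcal{P}_S(x)=\arg\min_{y\in S}\|x-y\|^2$. Restricted secant inequality: a differentiable function $f:\mathbb{R}^p\to\mathbb{R}$ with set of global minimizers $X^*$ satisfies the restricted secant inequality condition with constant $\nu>0$ if $$(\nabla f(x)-\nabla f(\mathcal{P}_{X^*}(x)))^\top(x-\mathcal{P}_{X^*}(x))\ge\nu\|x-\mathcal{P}_{X^*}(x)\|^2\quad\text{for all }x\in\mathbb{R}^p.$$ No convexity of $f$ or of the $f_i$ is assumed. *)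

theory Defs
  imports "HOL-Analysis.Analysis"
begin

text \<open>Stacked vectors \<open>col (x\<^sub>1, \<dots>, x\<^sub>n)\<close> with blocks in \<open>real^'p\<close> are elements of
  \<open>real^'p^'n\<close>; the norm of this type is the Euclidean norm of the concatenated vector.\<close>

definition weighted_graph :: "real^'n^'n \<Rightarrow> bool" where
  "weighted_graph A \<longleftrightarrow>
     transpose A = A \<and> (\<forall>i j. 0 \<le> A $ i $ j) \<and> (\<forall>i. A $ i $ i = 0)"

definition graph_connected :: "real^'n^'n \<Rightarrow> bool" where
  "graph_connected A \<longleftrightarrow> (\<forall>i j. (i, j) \<in> {(k, l). 0 < A $ k $ l}\<^sup>*)"

definition degree :: "real^'n^'n \<Rightarrow> 'n \<Rightarrow> real" where
  "degree A i = (\<Sum>j\<in>UNIV. A $ i $ j)"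

definition laplacian :: "real^'n^'n \<Rightarrow> real^'n^'n" where
  "laplacian A = (\<chi> i j. if i = j then degree A i else 0) - A"

definition eigenvalues :: "'a::field^'n^'n \<Rightarrow> 'a set" where
  "eigenvalues M = {\<mu>. \<exists>v. v \<noteq> 0 \<and> M *v v = \<mu> *s v}"

text \<open>The spectral radius ranges over the complex eigenvalues.  Both extrema are taken over
  finite sets; \<open>rho2\<close> is meaningful only if a positive eigenvalue exists, which is the case for
  the Laplacian of a connected graph with at least two vertices.\<close>

definition rho :: "real^'n^'n \<Rightarrow> real" where
  "rho M = Max (cmod ` eigenvalues (map_matrix complex_of_real M))"

definition rho2 :: "real^'n^'n \<Rightarrow> real" where
  "rho2 M = Min {\<mu> \<in> eigenvalues M. 0 < \<mu>}"

text \<open>Determined by its defining property at points of differentiability only.\<close>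

definition gradient :: "('a::real_inner \<Rightarrow> real) \<Rightarrow> 'a \<Rightarrow> 'a" where
  "gradient f x = (THE D. GDERIV f x :> D)"

definition global_minimizers :: "('a \<Rightarrow> real) \<Rightarrow> 'a set" where
  "global_minimizers f = {x. \<forall>y. f x \<le> f y}"

definition restricted_secant_inequality ::
  "('a::{real_inner,heine_borel} \<Rightarrow> real) \<Rightarrow> real \<Rightarrow> bool" where
  "restricted_secant_inequality f \<nu> \<longleftrightarrow>
     (\<forall>x. let x' = closest_point (global_minimizers f) x in
        (gradient f x - gradient f x') \<bullet> (x - x') \<ge> \<nu> * (norm (x - x'))\<^sup>2)"

text \<open>\<open>{\<one>\<^sub>n \<otimes> s | s \<in> S}\<close>\<close>

definition consensus_set :: "(real^'p) set \<Rightarrow> (real^'p^'n) set" where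
  "consensus_set S = {(\<chi> i. s) | s. s \<in> S}"

text \<open>On the half-line \<open>t \<ge> 0\<close>, with the one-sided derivative at \<open>t = 0\<close>.\<close>

definition solves_dynamics ::
  "('n::finite \<Rightarrow> real^'p \<Rightarrow> real) \<Rightarrow> real^'n^'n \<Rightarrow> real \<Rightarrow> real \<Rightarrow>
   (real \<Rightarrow> real^'p^'n) \<Rightarrow> (real \<Rightarrow> real^'p^'n) \<Rightarrow> bool" where
  "solves_dynamics f L \<alpha> \<beta> x v \<longleftrightarrow>
     (\<forall>t\<ge>0. \<forall>i.
        ((\<lambda>s. x s $ i) has_vector_derivative
           (- \<alpha> *\<^sub>R (\<Sum>j\<in>UNIV. L $ i $ j *\<^sub>R x t $ j) - \<beta> *\<^sub>R v t $ i
             - gradient (f i) (x t $ i))) (at t within {0..}) \<and>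
        ((\<lambda>s. v s $ i) has_vector_derivative
           (\<beta> *\<^sub>R (\<Sum>j\<in>UNIV. L $ i $ j *\<^sub>R x t $ j))) (at t within {0..}))"

end

theory Submission
  imports Defs
begin

text \<open>
  Why the flow converges.  Write \<open>T\<close> for the Laplacian acting on stacked vectors, \<open>F\<close> for the
  stacked gradient, \<open>P\<close> for the projection to \<open>X\<^sup>*\<close>-consensus vectors, \<open>g\<close> for the value of \<open>F\<close> on
  them (one value, by the singleton hypothesis), and put \<open>e = x - P x\<close> and \<open>w = v + g / \<beta>\<close>.
  The blocks of \<open>g\<close> sum to \<open>\<nabla>f = 0\<close> at a minimizer, and those of \<open>v\<close> sum to zero along the flow,
  so \<open>w\<close> stays in the space \<open>S\<close> of vectors with zero block mean, the orthogonal complement of the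
  consensus vectors.  As \<open>T\<close> kills consensus vectors, the flow reads
  \<open>x' = - \<alpha> T e - \<beta> w - (F x - g)\<close>, \<open>w' = \<beta> T e\<close>.

  On \<open>S\<close> the map \<open>T\<close> has a self-adjoint inverse \<open>Q\<close>.  In the derivative of
  \<open>(e \<bullet> e + w \<bullet> Q w) / 2\<close> the coupling terms \<open>\<plusminus> \<beta> (e \<bullet> w)\<close> cancel, which leaves the dissipation
  \<open>- (\<alpha> (e \<bullet> T e) + e \<bullet> (F x - g))\<close>.  This is at most \<open>- \<nu>\<^sub>1 (e \<bullet> e)\<close>
  (\<open>consensus_error_coercivity\<close>), but it does not see \<open>w\<close>.  The derivative of
  \<open>x \<bullet> w + \<alpha> / (2 \<beta>) (w \<bullet> w)\<close> contains \<open>- \<beta> (w \<bullet> w)\<close>, at the cost of terms in \<open>e\<close> that the weight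
  \<open>\<epsilon>\<^sub>1\<close> lets the first function absorb.  So
  \<open>V = \<epsilon>\<^sub>1 (e \<bullet> e + w \<bullet> Q w) + x \<bullet> w + \<alpha> / (2 \<beta>) (w \<bullet> w)\<close> satisfies
  \<open>V' \<le> - \<epsilon>\<^sub>2 (e \<bullet> e + w \<bullet> w)\<close> and \<open>\<beta> / (2 \<alpha>) (e \<bullet> e) \<le> V \<le> \<epsilon>\<^sub>3 (e \<bullet> e + w \<bullet> w)\<close>.  Hence \<open>V\<close> decays at
  rate \<open>\<epsilon>\<^sub>2 / \<epsilon>\<^sub>3\<close> and \<open>e\<close> at half that rate
  (\<open>primal_dual_flow_exponential_convergence\<close>).

  Coercivity holds although no convexity is available: \<open>e\<close> splits orthogonally into a consensus part
  \<open>u\<close>, on which the restricted secant inequality acts, and a disagreement part \<open>z \<in> S\<close>, on which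
  \<open>T\<close> is bounded below by \<open>\<rho>\<^sub>2(L)\<close>; by the Lipschitz bound the remaining terms cost at
  most half of the secant term and a multiple of \<open>z \<bullet> z\<close>, which a large \<open>\<alpha>\<close> outweighs.  The spectral bounds
  (\<open>rho2_le_quadratic_form\<close>, \<open>quadratic_form_le_rho\<close>) come from minimizing a quadratic form over
  a unit sphere: the minimum is attained, and at an eigenvector.
\<close>

section \<open>Eigenvalues and self-adjoint maps\<close>

text \<open>Eigenvectors to distinct eigenvalues are linearly independent.  Over an arbitrary field, so that
  one argument serves both the real and the complexified Laplacian; finiteness is what makes the
  extrema in the definitions of \<open>rho\<close> and \<open>rho2\<close> meaningful.\<close>

lemma card_eigenvalues_le:
  fixes M :: "'a::field^'n^'n"
  assumes "finite E" and "E \<subseteq> eigenvalues M"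
  shows "card E \<le> CARD('n)"
proof -
  have "\<forall>\<mu>\<in>E. \<exists>v. v \<noteq> 0 \<and> M *v v = \<mu> *s v"
    using assms(2) by (auto simp: eigenvalues_def)
  then obtain v where v: "\<And>\<mu>. \<mu> \<in> E \<Longrightarrow> v \<mu> \<noteq> 0 \<and> M *v v \<mu> = \<mu> *s v \<mu>"
    by metis
  have "inj_on v E \<and> vec.independent (v ` E)"
    using assms(1) v
  proof (induction E rule: finite_induct)
    case empty
    then show ?case by (simp add: vec.independent_empty)
  next
    case (insert \<mu> E)
    then have inj: "inj_on v E" and ind: "vec.independent (v ` E)" by auto
    have ev: "M *v v \<kappa> = \<kappa> *s v \<kappa>" if "\<kappa> \<in> insert \<mu> E" for \<kappa>
      using insert.prems that by auto
    have notin: "v \<mu> \<notin> vec.span (v ` E)"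
    proof
      assume "v \<mu> \<in> vec.span (v ` E)"
      then obtain u where "v \<mu> = (\<Sum>y\<in>v ` E. u y *s y)"
        using insert.hyps(1) by (auto simp: vec.span_finite)
      then have u: "v \<mu> = (\<Sum>\<kappa>\<in>E. u (v \<kappa>) *s v \<kappa>)"
        by (simp add: sum.reindex[OF inj] o_def)
      (* Compare the images of the linear relation under M and under multiplication by \<mu>. *)
      have "\<mu> *s v \<mu> = (\<Sum>\<kappa>\<in>E. u (v \<kappa>) *s (\<kappa> *s v \<kappa>))"
        using ev arg_cong[OF u, of "\<lambda>y. M *v y"]
        by (simp add: vec.sum vec.scale cong: sum.cong)
      moreover have "\<mu> *s v \<mu> = (\<Sum>\<kappa>\<in>E. u (v \<kappa>) *s (\<mu> *s v \<kappa>))"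
        using arg_cong[OF u, of "\<lambda>y. \<mu> *s y"]
        by (simp add: vec.scale_sum_right mult.commute)
      ultimately have "0 = (\<Sum>\<kappa>\<in>E. (u (v \<kappa>) * (\<kappa> - \<mu>)) *s v \<kappa>)"
        by (simp add: sum_subtractf algebra_simps vec.scale_left_diff_distrib)
      also have "\<dots> = (\<Sum>y\<in>v ` E. (u y * (inv_into E v y - \<mu>)) *s y)"
        by (simp add: sum.reindex[OF inj] o_def inv_into_f_f[OF inj] cong: sum.cong)
      finally have z: "(\<Sum>y\<in>v ` E. (u y * (inv_into E v y - \<mu>)) *s y) = 0" ..
      have "u (v \<kappa>) = 0" if "\<kappa> \<in> E" for \<kappa>
      proof -
        have "u (v \<kappa>) * (inv_into E v (v \<kappa>) - \<mu>) = 0"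
          using vec.independentD[OF ind _ subset_refl z] insert.hyps(1) that by blast
        then show ?thesis
          using that insert.hyps(2) by (auto simp: inv_into_f_f[OF inj])
      qed
      then have "v \<mu> = 0" by (subst u) simp
      then show False using insert.prems by auto
    qed
    then have "v \<mu> \<notin> v ` E" using vec.span_base by blast
    then show ?case
      using inj ind notin insert.hyps(2)
      by (auto simp: vec.independent_insert inj_on_insert)
  qed
  then have "card E = card (v ` E)" and "card (v ` E) \<le> vec.dim (v ` E)"
    using vec.independent_card_le_dim[of "v ` E" "v ` E"] by (auto simp: card_image)
  then show ?thesis using vec.dim_subset_UNIV[of "v ` E"] by (simp add: vec.dimension_def card_cart_basis)
qed

lemma finite_eigenvalues: "finite (eigenvalues (M :: 'a::field^'n^'n))"
proof (rule ccontr)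
  assume "infinite (eigenvalues M)"
  then obtain E where "E \<subseteq> eigenvalues M" "finite E" "card E = Suc CARD('n)"
    by (meson infinite_arbitrarily_large)
  then show False using card_eigenvalues_le[of E M] by simp
qed

text \<open>A minimizer \<open>v\<close> of \<open>x \<bullet> T x\<close> on the unit sphere of an invariant subspace is an eigenvector, since
  otherwise moving from \<open>v\<close> against the residual \<open>T v - \<mu> v\<close> would lower the Rayleigh quotient.\<close>

lemma self_adjoint_min_eigenvector:
  fixes T :: "'a::euclidean_space \<Rightarrow> 'a"
  assumes lin: "linear T" and adj: "\<And>x y. x \<bullet> T y = T x \<bullet> y"
    and S: "subspace S" "T ` S \<subseteq> S" "S \<noteq> {0}"
  obtains \<mu> v where "v \<in> S" "v \<noteq> 0" "T v = \<mu> *\<^sub>R v" "\<And>x. x \<in> S \<Longrightarrow> \<mu> * (norm x)\<^sup>2 \<le> x \<bullet> T x"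
proof -
  obtain z where z: "z \<in> S" "z \<noteq> 0" using S by (metis subspace_0 subsetI singletonD insertI1 subset_singletonD empty_iff)
  have "compact (S \<inter> sphere 0 1)"
    using S(1) by (simp add: closed_Int_compact closed_subspace)
  moreover have "z /\<^sub>R norm z \<in> S \<inter> sphere 0 1"
    using z S(1) by (simp add: subspace_scale)
  then have "S \<inter> sphere 0 1 \<noteq> {}" by blast
  moreover have "continuous_on (S \<inter> sphere 0 1) (\<lambda>x. x \<bullet> T x)"
    using lin by (intro continuous_intros linear_continuous_on) (simp add: linear_conv_bounded_linear)
  ultimately obtain v where v: "v \<in> S" "norm v = 1"
    and min: "\<And>x. x \<in> S \<Longrightarrow> norm x = 1 \<Longrightarrow> v \<bullet> T v \<le> x \<bullet> T x"
    using continuous_attains_inf[of "S \<inter> sphere 0 1" "\<lambda>x. x \<bullet> T x"]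
    by (metis IntD1 IntD2 IntI dist_0_norm mem_sphere)
  define \<mu> where "\<mu> = v \<bullet> T v"
  have bound: "\<mu> * (norm x)\<^sup>2 \<le> x \<bullet> T x" if "x \<in> S" for x
  proof (cases "x = 0")
    case False
    have "\<mu> \<le> (x /\<^sub>R norm x) \<bullet> T (x /\<^sub>R norm x)"
      unfolding \<mu>_def using that False S(1) by (intro min) (auto simp: subspace_scale)
    also have "\<dots> = (x \<bullet> T x) / (norm x)\<^sup>2"
      using lin by (simp add: linear_scale divide_inverse power2_eq_square)
    finally show ?thesis using False by (simp add: field_simps)
  qed simp
  define h where "h = T v - \<mu> *\<^sub>R v"
  define q where "q = h \<bullet> T h - \<mu> * (norm h)\<^sup>2"
  have hS: "h \<in> S" using S v by (auto simp: h_def subspace_diff subspace_scale)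
  have "h = 0"
  proof (rule ccontr)
    assume "h \<noteq> 0"
    define b where "b = (norm h)\<^sup>2"
    have "b > 0" using \<open>h \<noteq> 0\<close> by (simp add: b_def)
    have q0: "q \<ge> 0" using bound[OF hS] by (simp add: q_def)
    have b': "b = h \<bullet> T v - \<mu> * (h \<bullet> v)"
      by (simp add: b_def power2_norm_eq_inner) (simp add: h_def inner_diff_right)
    have expand: "0 \<le> 2 * t * b + t\<^sup>2 * q" for t
    proof -
      have "v + t *\<^sub>R h \<in> S" using v hS S(1) by (simp add: subspace_add subspace_scale)
      from bound[OF this] have "0 \<le> (v + t *\<^sub>R h) \<bullet> T (v + t *\<^sub>R h) - \<mu> * ((v + t *\<^sub>R h) \<bullet> (v + t *\<^sub>R h))"
        by (simp add: power2_norm_eq_inner)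
      also have "\<dots> = (v \<bullet> T v - \<mu> * (v \<bullet> v)) + t * (v \<bullet> T h + h \<bullet> T v - 2 * \<mu> * (h \<bullet> v)) + t\<^sup>2 * q"
        using lin unfolding q_def power2_norm_eq_inner
        by (simp add: linear_add linear_scale inner_add_left inner_add_right
            power2_eq_square algebra_simps inner_commute)
      also have "v \<bullet> v = 1" using v by (simp add: norm_eq_1)
      also have "v \<bullet> T h = h \<bullet> T v" using adj[of v h] by (simp add: inner_commute)
      also have "v \<bullet> T v - \<mu> * 1 = 0" by (simp add: \<mu>_def)
      also have "h \<bullet> T v + h \<bullet> T v - 2 * \<mu> * (h \<bullet> v) = 2 * b" using b' by simp
      finally show ?thesis by (simp add: mult.commute mult.left_commute)
    qed
    (* The step - b / (q + 1) makes the linear term dominate the quadratic one. *)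
    have "2 * (- b / (q + 1)) * b + (- b / (q + 1))\<^sup>2 * q = - (b\<^sup>2 * (q + 2)) / (q + 1)\<^sup>2"
      using q0 by (simp add: power2_eq_square divide_simps) (simp add: algebra_simps)
    moreover have "\<dots> < 0" using q0 \<open>b > 0\<close> by simp
    ultimately show False using expand[of "- b / (q + 1)"] by linarith
  qed
  moreover have "v \<noteq> 0" using v(2) by auto
  ultimately show thesis using that[of v \<mu>] v(1) bound by (simp add: h_def)
qed

text \<open>The pseudo-inverse of a Laplacian enters the Lyapunov function only through vectors of \<open>S\<close>, where
  it is an inverse.  Being injective on the invariant subspace \<open>S\<close>, the map \<open>T\<close> is onto \<open>S\<close> by
  dimension, and a linear left inverse does the job.\<close>

lemma subspace_self_adjoint_inverse:
  fixes T :: "'a::euclidean_space \<Rightarrow> 'a"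
  assumes lin: "linear T" and adj: "\<And>x y. x \<bullet> T y = T x \<bullet> y"
    and S: "subspace S" "T ` S \<subseteq> S" and r: "0 < r" "\<And>x. x \<in> S \<Longrightarrow> r * (norm x)\<^sup>2 \<le> x \<bullet> T x"
  obtains R where "linear R" "\<And>w. w \<in> S \<Longrightarrow> R w \<in> S \<and> T (R w) = w"
    "\<And>a b. a \<in> S \<Longrightarrow> b \<in> S \<Longrightarrow> a \<bullet> R b = R a \<bullet> b"
    "\<And>w. w \<in> S \<Longrightarrow> 0 \<le> w \<bullet> R w \<and> w \<bullet> R w \<le> (norm w)\<^sup>2 / r"
proof -
  have inj: "inj_on T S"
  proof (rule inj_onI)
    fix a b assume ab: "a \<in> S" "b \<in> S" "T a = T b"
    then have "a - b \<in> S" using S by (simp add: subspace_diff)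
    from r(2)[OF this] have "r * (norm (a - b))\<^sup>2 \<le> 0"
      using ab lin by (simp add: linear_diff)
    then show "a = b" using r(1) by (simp add: mult_le_0_iff)
  qed
  have "subspace (T ` S)" using lin S(1) by (rule linear_subspace_image)
  moreover have "dim (T ` S) = dim S"
    using lin inj S(1) by (simp add: dim_image_eq span_eq_iff[THEN iffD2])
  ultimately have surj: "T ` S = S"
    using S subspace_dim_equal[of "T ` S" S] by simp
  obtain R where R: "linear R" "range R \<subseteq> S" "\<And>z. z \<in> S \<Longrightarrow> R (T z) = z"
    using linear_exists_left_inverse_on[OF lin S(1) inj] by auto
  have TR: "R w \<in> S \<and> T (R w) = w" if "w \<in> S" for w
    using that R surj by (metis imageE)
  show thesis
  proof
    show "a \<bullet> R b = R a \<bullet> b" if "a \<in> S" "b \<in> S" for a b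
      using adj[of "R a" "R b"] TR that by simp
    show "0 \<le> w \<bullet> R w \<and> w \<bullet> R w \<le> (norm w)\<^sup>2 / r" if "w \<in> S" for w
    proof -
      have q: "r * (norm (R w))\<^sup>2 \<le> w \<bullet> R w" using r(2)[of "R w"] TR that by (simp add: inner_commute)
      moreover have cs: "w \<bullet> R w \<le> norm w * norm (R w)" by (rule norm_cauchy_schwarz)
      ultimately have "r * norm (R w) * norm (R w) \<le> norm w * norm (R w)" by (simp add: power2_eq_square)
      then have "r * norm (R w) \<le> norm w" by (cases "R w = 0") auto
      then have "norm w * (r * norm (R w)) \<le> norm w * norm w"
        by (intro mult_left_mono) auto
      moreover have "r * (w \<bullet> R w) \<le> r * (norm w * norm (R w))"
        using cs r(1) by (intro mult_left_mono) auto
      ultimately have "r * (w \<bullet> R w) \<le> norm w * norm w"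
        by (simp add: algebra_simps)
      moreover have "0 \<le> w \<bullet> R w" using q r(1) by (meson mult_nonneg_nonneg order_trans less_imp_le zero_le_power2)
      ultimately show ?thesis using r(1) by (simp add: field_simps power2_eq_square)
    qed
  qed (use R TR in auto)
qed

section \<open>Distance functions and differential inequalities\<close>

text \<open>The squared distance to a convex set is differentiable although the projection need not be:
  replacing one of the two projections by the other gives remainder bounds in both directions,
  the lower one because projections are nonexpansive.\<close>

lemma half_squared_distance_has_derivative:
  fixes C :: "'a::euclidean_space set"
  assumes C: "closed C" "convex C" "C \<noteq> {}"
  shows "((\<lambda>x. (norm (x - closest_point C x))\<^sup>2 / 2) has_derivative
           (\<lambda>h. h \<bullet> (x - closest_point C x))) (at x)"
proof -
  let ?P = "closest_point C" and ?\<phi> = "\<lambda>x. (norm (x - closest_point C x))\<^sup>2 / 2"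
  have PC: "?P y \<in> C" for y using closest_point_in_set C by auto
  have le: "?\<phi> y \<le> (norm (y - c))\<^sup>2 / 2" if "c \<in> C" for y c
    using closest_point_le[OF C(1) that, of y] by (simp add: dist_norm power_mono)
  have remainder: "\<bar>?\<phi> y - ?\<phi> x - (y - x) \<bullet> (x - ?P x)\<bar> \<le> (norm (y - x))\<^sup>2 / 2" for y
  proof -
    have sq: "(norm (a + b))\<^sup>2 = (norm a)\<^sup>2 + 2 * (a \<bullet> b) + (norm b)\<^sup>2" for a b :: 'a
      by (simp add: power2_norm_eq_inner inner_add_left inner_add_right inner_commute)
    have "(norm (y - ?P x))\<^sup>2 = (norm (y - x))\<^sup>2 + 2 * ((y - x) \<bullet> (x - ?P x)) + (norm (x - ?P x))\<^sup>2"
      using sq[of "y - x" "x - ?P x"] by simp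
    with le[OF PC, of y x] have upper: "?\<phi> y - ?\<phi> x - (y - x) \<bullet> (x - ?P x) \<le> (norm (y - x))\<^sup>2 / 2"
      by simp
    have "(norm (x - ?P y))\<^sup>2 = (norm (x - y))\<^sup>2 + 2 * ((x - y) \<bullet> (y - ?P y)) + (norm (y - ?P y))\<^sup>2"
      using sq[of "x - y" "y - ?P y"] by simp
    with le[OF PC, of x y] have lower:
      "?\<phi> y - ?\<phi> x \<ge> (y - x) \<bullet> (y - ?P y) - (norm (y - x))\<^sup>2 / 2"
      by (simp add: inner_diff_left norm_minus_commute)
    have "(y - x) \<bullet> (?P y - ?P x) \<le> norm (y - x) * norm (?P y - ?P x)"
      by (rule norm_cauchy_schwarz)
    also have "\<dots> \<le> norm (y - x) * norm (y - x)"
      using closest_point_lipschitz[OF C(2,1,3), of y x] by (intro mult_left_mono) (auto simp: dist_norm)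
    also have "\<dots> = (y - x) \<bullet> (y - x)" by (simp add: dot_square_norm power2_eq_square)
    finally have "0 \<le> (y - x) \<bullet> ((y - ?P y) - (x - ?P x))"
      by (simp add: inner_diff_right)
    then have "(y - x) \<bullet> (x - ?P x) \<le> (y - x) \<bullet> (y - ?P y)"
      by (simp add: inner_diff_right)
    then show ?thesis using upper lower unfolding abs_le_iff by linarith
  qed
  show ?thesis
    unfolding has_derivative_at_within_iff_Ex has_derivative_within_alt
  proof (safe, goal_cases)
    case 1 show ?case by (rule bounded_linear_inner_left)
  next
    case (2 e)
    show ?case
    proof (intro exI[of _ "2 * e"] conjI ballI impI)
      show "0 < 2 * e" using 2 by simp
      fix y assume "norm (y - x) < 2 * e"
      then have "norm (y - x) * norm (y - x) \<le> 2 * e * norm (y - x)" by (intro mult_right_mono) auto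
      then show "norm (?\<phi> y - ?\<phi> x - (y - x) \<bullet> (x - ?P x)) \<le> e * norm (y - x)"
        using remainder[of y] by (simp add: power2_eq_square)
    qed
  qed
qed

text \<open>\<open>V t * exp (c * t)\<close> is nonincreasing.  The derivative at \<open>0\<close> is one-sided; there
  continuity takes its place in the monotonicity argument.\<close>

lemma exponential_decay_if_differential_inequality:
  fixes V V' :: "real \<Rightarrow> real"
  assumes der: "\<And>t. 0 \<le> t \<Longrightarrow> (V has_real_derivative V' t) (at t within {0..})"
    and le: "\<And>t. 0 \<le> t \<Longrightarrow> V' t \<le> - c * V t" and t: "0 \<le> t"
  shows "V t \<le> V 0 * exp (- c * t)"
proof -
  let ?W = "\<lambda>s. V s * exp (c * s)"
  have d: "(?W has_real_derivative (V' s + c * V s) * exp (c * s)) (at s within {0..})" if "0 \<le> s" for s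
    using der[OF that] by (auto intro!: derivative_eq_intros simp: algebra_simps)
  have "?W t \<le> ?W 0"
  proof (rule DERIV_nonpos_imp_decreasing_open[OF t])
    fix s assume s: "0 < s" "s < t"
    have "(?W has_real_derivative (V' s + c * V s) * exp (c * s)) (at s)"
      using d[of s] s by (simp add: at_within_interior[of s "{0..}"] interior_real_atLeast)
    moreover have "(V' s + c * V s) * exp (c * s) \<le> 0"
      using le[of s] s by (simp add: mult_nonpos_nonneg)
    ultimately show "\<exists>y. (?W has_real_derivative y) (at s) \<and> y \<le> 0" by blast
  next
    have "continuous_on {0..} ?W"
      unfolding continuous_on_eq_continuous_within using d by (auto intro: DERIV_continuous)
    then show "continuous_on {0..t} ?W" by (rule continuous_on_subset) auto
  qed
  then show ?thesis by (simp add: exp_minus field_simps)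
qed

section \<open>The Lyapunov function of the primal-dual flow\<close>

text \<open>The Lyapunov argument for a flow driven by a self-adjoint map \<open>T\<close> on a Euclidean space.  The
  constant \<open>\<eta>\<close> weights the part of the Lyapunov function in which the coupling terms cancel; \<open>\<sigma>\<close> and
  \<open>\<tau>\<close> relate its dissipation and its size to \<open>e \<bullet> e + w \<bullet> w\<close>.\<close>

lemma primal_dual_flow_exponential_convergence:
  fixes T F :: "'a::euclidean_space \<Rightarrow> 'a" and C S :: "'a set" and x v :: "real \<Rightarrow> 'a"
  defines "P \<equiv> closest_point C"
  assumes T: "linear T" "\<And>y z. y \<bullet> T z = T y \<bullet> z"
    and S: "subspace S" "range T \<subseteq> S"
    and gap: "0 < r" "\<And>y. y \<in> S \<Longrightarrow> r * (norm y)\<^sup>2 \<le> y \<bullet> T y"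
    and upper: "\<And>y. y \<bullet> T y \<le> R * (norm y)\<^sup>2"
    and C: "closed C" "convex C" "C \<noteq> {}" and orth: "\<And>c s. c \<in> C \<Longrightarrow> s \<in> S \<Longrightarrow> c \<bullet> s = 0"
    and g: "g \<in> S" and lip: "\<And>y. norm (F y - g) \<le> l * norm (y - P y)"
    and coercive: "\<And>y. \<kappa> * (norm (y - P y))\<^sup>2 \<le> \<alpha> * ((y - P y) \<bullet> T (y - P y)) + (y - P y) \<bullet> (F y - g)"
    and pos: "0 < \<alpha>" "0 < \<beta>" "0 < \<kappa>"
    and \<eta>: "l\<^sup>2 / (2 * \<beta>) + R * \<beta> \<le> \<eta> * \<kappa>" "\<beta> / \<alpha> \<le> \<eta>"
    and \<sigma>: "0 < \<sigma>" "\<sigma> \<le> \<beta> / 2" "\<sigma> \<le> \<eta> * \<kappa>"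
    and \<tau>: "\<eta> / r + \<alpha> / (2 * \<beta>) + 1 / 2 \<le> \<tau>" "\<eta> + 1 / 2 \<le> \<tau>"
    and x': "\<And>t. 0 \<le> t \<Longrightarrow>
        (x has_vector_derivative - \<alpha> *\<^sub>R T (x t) - \<beta> *\<^sub>R v t - F (x t)) (at t within {0..})"
    and v': "\<And>t. 0 \<le> t \<Longrightarrow> (v has_vector_derivative \<beta> *\<^sub>R T (x t)) (at t within {0..})"
    and v0: "v 0 \<in> S"
  shows "\<exists>K\<ge>0. \<forall>t\<ge>0. norm (x t - P (x t)) \<le> K * exp (- (\<sigma> / (2 * \<tau>)) * t)"
proof -
  have \<eta>_pos: "0 < \<eta>" using \<eta>(2) pos by (meson divide_pos_pos less_le_trans)
  have \<tau>_pos: "0 < \<tau>" using \<tau>(2) \<eta>_pos by linarith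
  have TS: "T y \<in> S" for y using S(2) by auto
  have PC: "P y \<in> C" for y using closest_point_in_set C by (auto simp: P_def)
  have TP: "T (y - P y) = T y" for y
  proof -
    have "T (P y) \<bullet> T (P y) = 0" using T(2)[of "P y" "T (P y)"] orth[OF PC TS] by simp
    then show ?thesis using T(1) by (simp add: linear_diff)
  qed
  have TSS: "T ` S \<subseteq> S" using TS by auto
  obtain Q where Q: "linear Q" "\<And>w. w \<in> S \<Longrightarrow> Q w \<in> S \<and> T (Q w) = w"
    "\<And>a b. a \<in> S \<Longrightarrow> b \<in> S \<Longrightarrow> a \<bullet> Q b = Q a \<bullet> b"
    "\<And>w. w \<in> S \<Longrightarrow> 0 \<le> w \<bullet> Q w \<and> w \<bullet> Q w \<le> (norm w)\<^sup>2 / r"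
    by (rule subspace_self_adjoint_inverse[OF T S(1) TSS gap]) (assumption, rule that)
  (* v starts in S and its velocity lies in S, so v is constant in every direction orthogonal to S. *)
  have vS: "v t \<in> S" if "0 \<le> t" for t
  proof -
    have "v t \<bullet> u = 0" if u: "u \<in> S\<^sup>\<bottom>" for u
    proof -
      have "((\<lambda>s. v s \<bullet> u) has_vector_derivative 0) (at s within {0..})" if "0 \<le> s" for s
      proof -
        have "T (x s) \<bullet> u = 0" using u TS by (simp add: orthogonal_comp_def orthogonal_def)
        then show ?thesis
          using bounded_linear.has_vector_derivative[OF bounded_linear_inner_left v'[OF that], of u] by simp
      qed
      then obtain c where c: "\<And>s. s \<in> {0..} \<Longrightarrow> v s \<bullet> u = c"
        using has_vector_derivative_zero_constant[of "{0..}" "\<lambda>s. v s \<bullet> u"] by force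
      have "v 0 \<bullet> u = 0" using u v0 by (auto simp: orthogonal_comp_def orthogonal_def)
      then show ?thesis using c[of 0] c[of t] \<open>0 \<le> t\<close> by simp
    qed
    then have "v t \<in> S\<^sup>\<bottom>\<^sup>\<bottom>" by (auto simp: orthogonal_comp_def orthogonal_def inner_commute)
    then show ?thesis using orthogonal_comp_self[OF S(1)] by simp
  qed
  define e where "e t = x t - P (x t)" for t
  (* - g / \<beta> is the equilibrium of v, so w is the error of the dual variable. *)
  define w where "w t = v t + g /\<^sub>R \<beta>" for t
  define D where "D t = F (x t) - g" for t
  have wS: "w t \<in> S" if "0 \<le> t" for t
    using vS[OF that] g S(1) by (simp add: w_def subspace_add subspace_scale)
  have xe: "x t \<bullet> s = e t \<bullet> s" if "s \<in> S" for s t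
    using orth[OF PC that, of "x t"] by (simp add: e_def inner_diff_left)
  have Te: "T (x t) = T (e t)" for t using TP[of "x t"] by (simp add: e_def)
  have dx: "(x has_vector_derivative - \<alpha> *\<^sub>R T (e t) - \<beta> *\<^sub>R w t - D t) (at t within {0..})" if "0 \<le> t" for t
    by (rule has_vector_derivative_eq_rhs[OF x'[OF that]])
       (use pos(2) in \<open>simp add: Te w_def D_def algebra_simps\<close>)
  have dw: "(w has_vector_derivative \<beta> *\<^sub>R T (e t)) (at t within {0..})" if "0 \<le> t" for t
    using v'[OF that] unfolding w_def by (auto intro!: derivative_eq_intros simp: Te)
  (* The coefficient \<alpha> / (2 * \<beta>) makes \<alpha> * (w t \<bullet> T (e t)) cancel against the contribution of
     - \<alpha> *\<^sub>R T (e t) to the derivative of x t \<bullet> w t. *)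
  define V where "V t = \<eta> * (norm (e t))\<^sup>2 + \<eta> * (w t \<bullet> Q (w t)) + x t \<bullet> w t + \<alpha> / (2 * \<beta>) * (w t \<bullet> w t)" for t
  define V' where "V' t = - 2 * \<eta> * (\<alpha> * (e t \<bullet> T (e t)) + e t \<bullet> D t)
      + (\<beta> * (e t \<bullet> T (e t)) - \<beta> * (norm (w t))\<^sup>2 - D t \<bullet> w t)" for t
  have dV: "(V has_real_derivative V' t) (at t within {0..})" if t: "0 \<le> t" for t
  proof -
    let ?x' = "- \<alpha> *\<^sub>R T (e t) - \<beta> *\<^sub>R w t - D t"
    have d1: "((\<lambda>s. (norm (e s))\<^sup>2 / 2) has_vector_derivative ?x' \<bullet> e t) (at t within {0..})"
      using has_derivative_compose[OF dx[OF t, unfolded has_vector_derivative_def]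
        half_squared_distance_has_derivative[OF C]]
      by (simp add: has_vector_derivative_def e_def P_def)
    have d2: "((\<lambda>s. w s \<bullet> Q (w s)) has_vector_derivative
        w t \<bullet> Q (\<beta> *\<^sub>R T (e t)) + (\<beta> *\<^sub>R T (e t)) \<bullet> Q (w t)) (at t within {0..})"
      using Q(1) dw[OF t] by (intro bounded_bilinear.has_vector_derivative[OF bounded_bilinear_inner]
        bounded_linear.has_vector_derivative[of Q]) (auto simp: linear_conv_bounded_linear)
    have d3: "((\<lambda>s. x s \<bullet> w s) has_vector_derivative
        x t \<bullet> (\<beta> *\<^sub>R T (e t)) + ?x' \<bullet> w t) (at t within {0..})"
      using dx[OF t] dw[OF t] by (rule bounded_bilinear.has_vector_derivative[OF bounded_bilinear_inner])
    have d4: "((\<lambda>s. w s \<bullet> w s) has_vector_derivative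
        w t \<bullet> (\<beta> *\<^sub>R T (e t)) + (\<beta> *\<^sub>R T (e t)) \<bullet> w t) (at t within {0..})"
      using dw[OF t] dw[OF t] by (rule bounded_bilinear.has_vector_derivative[OF bounded_bilinear_inner])
    have "T (e t) \<bullet> Q (w t) = e t \<bullet> w t"
      using T(2)[of "e t" "Q (w t)"] Q(2) wS[OF t] by simp
    moreover have "w t \<bullet> Q (T (e t)) = T (e t) \<bullet> Q (w t)"
      using Q(3)[OF wS[OF t] TS, of "e t"] by (simp add: inner_commute)
    ultimately have q: "w t \<bullet> Q (\<beta> *\<^sub>R T (e t)) + (\<beta> *\<^sub>R T (e t)) \<bullet> Q (w t) = 2 * \<beta> * (e t \<bullet> w t)"
      using Q(1) by (simp add: linear_scale)
    have xT: "x t \<bullet> T (e t) = e t \<bullet> T (e t)" by (rule xe[OF TS])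
    have "V' t = 2 * \<eta> * (?x' \<bullet> e t) + \<eta> * (2 * \<beta> * (e t \<bullet> w t))
        + (x t \<bullet> (\<beta> *\<^sub>R T (e t)) + ?x' \<bullet> w t)
        + \<alpha> / (2 * \<beta>) * (w t \<bullet> (\<beta> *\<^sub>R T (e t)) + (\<beta> *\<^sub>R T (e t)) \<bullet> w t)"
      using pos(2) by (simp add: V'_def xT inner_diff_left inner_add_left power2_norm_eq_inner
          inner_commute[of "T (e t)"] inner_commute[of "D t"] inner_commute[of "w t" "e t"] field_simps)
    moreover have "V = (\<lambda>s. 2 * \<eta> * ((norm (e s))\<^sup>2 / 2) + \<eta> * (w s \<bullet> Q (w s)) + x s \<bullet> w s + \<alpha> / (2 * \<beta>) * (w s \<bullet> w s))"
      by (simp add: V_def fun_eq_iff)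
    ultimately show ?thesis
      unfolding has_real_derivative_iff_has_vector_derivative
      using d1 d2 d3 d4 unfolding q
      by (simp only:) (intro has_vector_derivative_add has_vector_derivative_mult_right)
  qed
  have V'_le: "V' t \<le> - \<sigma> * ((norm (e t))\<^sup>2 + (norm (w t))\<^sup>2)" for t
  proof -
    have "\<eta> * (\<kappa> * (norm (e t))\<^sup>2) \<le> \<eta> * (\<alpha> * (e t \<bullet> T (e t)) + e t \<bullet> D t)"
      using coercive[of "x t"] \<eta>_pos by (intro mult_left_mono) (auto simp: e_def D_def)
    moreover have "\<beta> * (e t \<bullet> T (e t)) \<le> \<beta> * (R * (norm (e t))\<^sup>2)"
      using upper pos(2) by (intro mult_left_mono) auto
    moreover have "- (D t \<bullet> w t) \<le> l\<^sup>2 / (2 * \<beta>) * (norm (e t))\<^sup>2 + \<beta> / 2 * (norm (w t))\<^sup>2"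
    proof -
      have "- (D t \<bullet> w t) \<le> norm (D t) * norm (w t)"
        using norm_cauchy_schwarz[of "- D t" "w t"] by simp
      also have "\<dots> \<le> l * norm (e t) * norm (w t)"
        using lip[of "x t"] by (intro mult_right_mono) (auto simp: D_def e_def)
      also have "\<dots> \<le> l\<^sup>2 / (2 * \<beta>) * (norm (e t))\<^sup>2 + \<beta> / 2 * (norm (w t))\<^sup>2"
      proof -
        (* Young's inequality, with weights that use up half of the dissipation in w. *)
        have "0 \<le> (l * norm (e t) - \<beta> * norm (w t))\<^sup>2 / (2 * \<beta>)" using pos(2) by simp
        then show ?thesis using pos(2) by (simp add: power2_eq_square field_simps)
      qed
      finally show ?thesis .
    qed
    moreover have "(l\<^sup>2 / (2 * \<beta>) + R * \<beta>) * (norm (e t))\<^sup>2 \<le> \<eta> * \<kappa> * (norm (e t))\<^sup>2"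
      using \<eta>(1) by (intro mult_right_mono) auto
    moreover have "\<sigma> * (norm (e t))\<^sup>2 \<le> \<eta> * \<kappa> * (norm (e t))\<^sup>2" "\<sigma> * (norm (w t))\<^sup>2 \<le> \<beta> / 2 * (norm (w t))\<^sup>2"
      by (rule mult_right_mono[OF \<sigma>(3)], simp) (rule mult_right_mono[OF \<sigma>(2)], simp)
    ultimately show ?thesis unfolding V'_def by (simp add: algebra_simps)
  qed
  have V_upper: "V t \<le> \<tau> * ((norm (e t))\<^sup>2 + (norm (w t))\<^sup>2)" if t: "0 \<le> t" for t
  proof -
    have "x t \<bullet> w t \<le> (norm (e t))\<^sup>2 / 2 + (norm (w t))\<^sup>2 / 2"
      using norm_cauchy_schwarz[of "e t" "w t"] sum_squares_bound[of "norm (e t)" "norm (w t)"]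
        xe[OF wS[OF t]] by simp
    moreover have "\<eta> * (w t \<bullet> Q (w t)) \<le> \<eta> / r * (norm (w t))\<^sup>2"
      using mult_left_mono[OF conjunct2[OF Q(4)[OF wS[OF t]]], of \<eta>] \<eta>_pos by simp
    moreover have "(\<eta> / r + \<alpha> / (2 * \<beta>) + 1 / 2) * (norm (w t))\<^sup>2 \<le> \<tau> * (norm (w t))\<^sup>2"
      "(\<eta> + 1 / 2) * (norm (e t))\<^sup>2 \<le> \<tau> * (norm (e t))\<^sup>2"
      by (rule mult_right_mono[OF \<tau>(1)], simp) (rule mult_right_mono[OF \<tau>(2)], simp)
    ultimately show ?thesis unfolding V_def power2_norm_eq_inner[of "w t", symmetric]
      by (simp add: algebra_simps)
  qed
  have V_lower: "\<beta> / (2 * \<alpha>) * (norm (e t))\<^sup>2 \<le> V t" if t: "0 \<le> t" for t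
  proof -
    (* Completing the square costs half of the \<beta> / \<alpha> that \<eta> provides. *)
    have "0 \<le> (norm (\<beta> *\<^sub>R e t + \<alpha> *\<^sub>R w t))\<^sup>2 / (2 * \<alpha> * \<beta>)" using pos by simp
    also have "\<dots> = \<beta> / (2 * \<alpha>) * (norm (e t))\<^sup>2 + e t \<bullet> w t + \<alpha> / (2 * \<beta>) * (w t \<bullet> w t)"
      using pos unfolding power2_norm_eq_inner
      by (simp add: inner_add_left inner_add_right inner_commute field_simps)
    finally have "- (\<beta> / (2 * \<alpha>) * (norm (e t))\<^sup>2) \<le> x t \<bullet> w t + \<alpha> / (2 * \<beta>) * (w t \<bullet> w t)"
      using xe[OF wS[OF t]] by simp
    moreover have "\<beta> / \<alpha> * (norm (e t))\<^sup>2 \<le> \<eta> * (norm (e t))\<^sup>2"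
      using \<eta>(2) by (intro mult_right_mono) auto
    moreover have "\<beta> / \<alpha> * (norm (e t))\<^sup>2 = 2 * (\<beta> / (2 * \<alpha>) * (norm (e t))\<^sup>2)" by simp
    moreover have "0 \<le> \<eta> * (w t \<bullet> Q (w t))" using Q(4)[OF wS[OF t]] \<eta>_pos by simp
    ultimately show ?thesis unfolding V_def by linarith
  qed
  have decay: "V t \<le> V 0 * exp (- (\<sigma> / \<tau>) * t)" if "0 \<le> t" for t
  proof (rule exponential_decay_if_differential_inequality[OF dV _ that])
    fix s :: real assume "0 \<le> s"
    from V_upper[OF this] have "\<sigma> / \<tau> * V s \<le> \<sigma> / \<tau> * (\<tau> * ((norm (e s))\<^sup>2 + (norm (w s))\<^sup>2))"
      using \<sigma>(1) \<tau>_pos by (intro mult_left_mono) auto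
    also have "\<dots> = \<sigma> * ((norm (e s))\<^sup>2 + (norm (w s))\<^sup>2)" using \<tau>_pos by simp
    finally show "V' s \<le> - (\<sigma> / \<tau>) * V s" using V'_le[of s] by simp
  qed
  define K where "K = sqrt (2 * \<alpha> / \<beta> * V 0)"
  have "0 \<le> \<beta> / (2 * \<alpha>) * (norm (e 0))\<^sup>2" using pos by simp
  then have V0: "0 \<le> V 0" using V_lower[of 0] by simp
  show ?thesis
  proof (intro exI[of _ K] conjI allI impI)
    show "0 \<le> K" using V0 pos by (simp add: K_def)
    fix t :: real assume t: "0 \<le> t"
    have "(norm (e t))\<^sup>2 = 2 * \<alpha> / \<beta> * (\<beta> / (2 * \<alpha>) * (norm (e t))\<^sup>2)" using pos by simp
    also have "\<dots> \<le> 2 * \<alpha> / \<beta> * (V 0 * exp (- (\<sigma> / \<tau>) * t))"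
      using V_lower[OF t] decay[OF t] pos by (intro mult_left_mono) auto
    also have "\<dots> = (K * exp (- (\<sigma> / (2 * \<tau>)) * t))\<^sup>2"
    proof -
      have "K\<^sup>2 = 2 * \<alpha> / \<beta> * V 0" using V0 pos by (simp add: K_def)
      moreover have "exp (- (\<sigma> / \<tau>) * t) = (exp (- (\<sigma> / (2 * \<tau>)) * t))\<^sup>2"
        using exp_double[of "- (\<sigma> / (2 * \<tau>)) * t"] by simp
      ultimately show ?thesis by (simp only: power_mult_distrib mult.assoc)
    qed
    finally show "norm (x t - P (x t)) \<le> K * exp (- (\<sigma> / (2 * \<tau>)) * t)"
      unfolding e_def by (rule power2_le_imp_le) (use \<open>0 \<le> K\<close> in simp)
  qed
qed

section \<open>The graph Laplacian on stacked vectors\<close>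

text \<open>The Kronecker product \<open>M \<otimes> I\<^sub>p\<close> as a map on stacked vectors.\<close>

definition block_mult :: "real^'n^'n \<Rightarrow> real^'p^'n \<Rightarrow> real^'p^'n" where
  "block_mult M x = (\<chi> i. \<Sum>j\<in>UNIV. M $ i $ j *\<^sub>R x $ j)"

lemma linear_block_mult: "linear (block_mult M)"
  by (rule linearI) (simp_all add: block_mult_def vec_eq_iff scaleR_add_right sum.distrib
      scaleR_sum_right mult.commute)

text \<open>Stated at the type of stacked vectors, so that rewriting stops at the blocks instead of descending
  to their coordinates.\<close>

lemma inner_blocks: "x \<bullet> y = (\<Sum>i\<in>UNIV. x $ i \<bullet> y $ i)" for x y :: "real^'p^'n"
  by (rule inner_vec_def)

lemma block_mult_self_adjoint:
  fixes x y :: "real^'p^'n"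
  assumes "transpose M = M"
  shows "x \<bullet> block_mult M y = block_mult M x \<bullet> y"
proof -
  have "M $ i $ j = M $ j $ i" for i j using assms by (metis transpose_def vec_lambda_beta)
  then show ?thesis
    by (simp add: block_mult_def inner_blocks inner_sum_left inner_sum_right)
       (subst sum.swap, simp)
qed

text \<open>Some coordinate column of a block eigenvector is nonzero, and it is an eigenvector of the matrix
  itself.  Thus extremal eigenvalues may be sought among stacked vectors.\<close>

lemma block_mult_eigenvector:
  fixes y :: "real^'p^'n"
  assumes "y \<noteq> 0" "block_mult M y = \<mu> *\<^sub>R y"
  shows "\<mu> \<in> eigenvalues M" "complex_of_real \<mu> \<in> eigenvalues (map_matrix complex_of_real M)"
proof -
  obtain i k where ik: "y $ i $ k \<noteq> 0" using assms(1) by (auto simp: vec_eq_iff)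
  have row: "(\<Sum>j\<in>UNIV. M $ i $ j * y $ j $ k) = \<mu> * y $ i $ k" for i
    using arg_cong[OF assms(2), of "\<lambda>z. z $ i $ k"] by (simp add: block_mult_def)
  show "\<mu> \<in> eigenvalues M" unfolding eigenvalues_def
  proof (intro CollectI exI[of _ "\<chi> i. y $ i $ k"] conjI)
    show "(\<chi> i. y $ i $ k) \<noteq> 0" using ik by (auto simp: vec_eq_iff)
    show "M *v (\<chi> i. y $ i $ k) = \<mu> *s (\<chi> i. y $ i $ k)"
      using row by (simp add: vec_eq_iff matrix_vector_mult_def)
  qed
  show "complex_of_real \<mu> \<in> eigenvalues (map_matrix complex_of_real M)" unfolding eigenvalues_def
  proof (intro CollectI exI[of _ "\<chi> i. complex_of_real (y $ i $ k)"] conjI)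
    show "(\<chi> i. complex_of_real (y $ i $ k)) \<noteq> 0" using ik by (auto simp: vec_eq_iff)
    show "map_matrix complex_of_real M *v (\<chi> i. complex_of_real (y $ i $ k))
        = complex_of_real \<mu> *s (\<chi> i. complex_of_real (y $ i $ k))"
      using row by (simp add: vec_eq_iff matrix_vector_mult_def map_matrix_def flip: of_real_mult of_real_sum)
  qed
qed

text \<open>The largest value of the Rayleigh quotient is minus the smallest eigenvalue of \<open>- M\<close>.\<close>

lemma quadratic_form_le_rho:
  fixes y :: "real^'p^'n"
  assumes "transpose M = M"
  shows "y \<bullet> block_mult M y \<le> rho M * (norm y)\<^sup>2"
proof -
  let ?T = "\<lambda>y :: real^'p^'n. - block_mult M y"
  have "(\<chi> i k. 1) \<noteq> (0 :: real^'p^'n)" by (simp add: vec_eq_iff)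
  then have ne: "(UNIV :: (real^'p^'n) set) \<noteq> {0}" by auto
  have lin: "linear ?T" using linear_block_mult by (rule linear_compose_neg)
  have adj: "x \<bullet> ?T y = ?T x \<bullet> y" for x y
    using block_mult_self_adjoint[OF assms, of x y] by simp
  obtain \<mu> v where v: "v \<noteq> 0" "?T v = \<mu> *\<^sub>R v" and le: "\<And>x. x \<in> UNIV \<Longrightarrow> \<mu> * (norm x)\<^sup>2 \<le> x \<bullet> ?T x"
    by (rule self_adjoint_min_eigenvector[OF lin adj subspace_UNIV subset_UNIV ne]) (rule that)
  have "block_mult M v = (- \<mu>) *\<^sub>R v" using arg_cong[OF v(2), of uminus] by simp
  then have "complex_of_real (- \<mu>) \<in> eigenvalues (map_matrix complex_of_real M)"
    using block_mult_eigenvector(2) v(1) by blast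
  then have "cmod (complex_of_real (- \<mu>)) \<le> rho M"
    unfolding rho_def by (intro Max_ge imageI finite_imageI finite_eigenvalues)
  then have "- \<mu> \<le> rho M" by simp
  then have "- \<mu> * (norm y)\<^sup>2 \<le> rho M * (norm y)\<^sup>2" by (intro mult_right_mono) auto
  then show ?thesis using le[of y] by simp
qed

definition zero_mean :: "(real^'p^'n) set" where
  "zero_mean = {y. (\<Sum>i\<in>UNIV. y $ i) = 0}"

lemma subspace_zero_mean: "subspace zero_mean"
  by (simp add: zero_mean_def subspace_def sum.distrib flip: scaleR_sum_right)

lemma consensus_orthogonal_zero_mean:
  "s \<in> zero_mean \<Longrightarrow> (\<chi> i. c) \<bullet> s = 0"
  by (simp add: zero_mean_def inner_blocks flip: inner_sum_right)

lemma block_mult_laplacian: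
  "block_mult (laplacian A) y $ i = (\<Sum>j\<in>UNIV. A $ i $ j *\<^sub>R (y $ i - y $ j))"
proof -
  have "laplacian A $ i $ j *\<^sub>R y $ j = (if j = i then degree A i *\<^sub>R y $ i else 0) - A $ i $ j *\<^sub>R y $ j" for j
    by (simp add: laplacian_def scaleR_left_diff_distrib)
  then show ?thesis
    by (simp add: block_mult_def sum_subtractf degree_def scaleR_right_diff_distrib scaleR_sum_left)
qed

lemma weighted_graph_sym: "weighted_graph A \<Longrightarrow> A $ i $ j = A $ j $ i"
  by (simp add: weighted_graph_def transpose_def vec_eq_iff)

lemma laplacian_symmetric:
  "weighted_graph A \<Longrightarrow> transpose (laplacian A) = laplacian A"
  by (simp add: weighted_graph_def laplacian_def vec_eq_iff transpose_def)

lemma block_mult_laplacian_zero_mean: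
  assumes "weighted_graph A"
  shows "block_mult (laplacian A) y \<in> zero_mean"
proof -
  note sym = weighted_graph_sym[OF assms]
  have "(\<Sum>i\<in>UNIV. \<Sum>j\<in>UNIV. A $ i $ j *\<^sub>R y $ i) = (\<Sum>i\<in>UNIV. \<Sum>j\<in>UNIV. A $ i $ j *\<^sub>R y $ j)"
    by (subst sum.swap) (simp add: sym)
  then show ?thesis
    by (simp add: zero_mean_def block_mult_laplacian scaleR_right_diff_distrib sum_subtractf)
qed

lemma laplacian_quadratic_form:
  assumes "weighted_graph A"
  shows "y \<bullet> block_mult (laplacian A) y = (\<Sum>i\<in>UNIV. \<Sum>j\<in>UNIV. A $ i $ j * (norm (y $ i - y $ j))\<^sup>2) / 2"
proof -
  note sym = weighted_graph_sym[OF assms]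
  have "y \<bullet> block_mult (laplacian A) y = (\<Sum>i\<in>UNIV. \<Sum>j\<in>UNIV. A $ i $ j * (y $ i \<bullet> (y $ i - y $ j)))"
    by (simp add: inner_blocks block_mult_laplacian inner_sum_right)
  moreover have "\<dots> = (\<Sum>i\<in>UNIV. \<Sum>j\<in>UNIV. A $ i $ j * (y $ j \<bullet> (y $ j - y $ i)))"
    by (subst sum.swap) (simp add: sym)
  moreover have "(\<Sum>i\<in>UNIV. \<Sum>j\<in>UNIV. A $ i $ j * (norm (y $ i - y $ j))\<^sup>2)
      = (\<Sum>i\<in>UNIV. \<Sum>j\<in>UNIV. A $ i $ j * (y $ i \<bullet> (y $ i - y $ j)))
        + (\<Sum>i\<in>UNIV. \<Sum>j\<in>UNIV. A $ i $ j * (y $ j \<bullet> (y $ j - y $ i)))"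
    unfolding sum.distrib[symmetric]
    by (intro sum.cong refl) (simp add: power2_norm_eq_inner inner_diff_left inner_diff_right inner_commute algebra_simps)
  ultimately show ?thesis by simp
qed

text \<open>All terms of the quadratic form are nonnegative, so each vanishes and neighbours agree; walk along
  a path.\<close>

lemma laplacian_kernel:
  assumes A: "weighted_graph A" "graph_connected A" and y: "y \<bullet> block_mult (laplacian A) y = 0"
  shows "y $ i = y $ j"
proof -
  have nn: "0 \<le> A $ i $ j" for i j using A(1) by (auto simp: weighted_graph_def)
  have "(\<Sum>i\<in>UNIV. \<Sum>j\<in>UNIV. A $ i $ j * (norm (y $ i - y $ j))\<^sup>2) = 0"
    using y laplacian_quadratic_form[OF A(1), of y] by simp
  then have z: "A $ i $ j * (norm (y $ i - y $ j))\<^sup>2 = 0" for i j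
    using nn by (simp add: sum_nonneg_eq_0_iff sum_nonneg)
  have "(i, j) \<in> {(k, l). 0 < A $ k $ l}\<^sup>*" using A(2) by (simp add: graph_connected_def)
  then show ?thesis
  proof (induction rule: rtrancl_induct)
    case (step k l)
    then show ?case using z[of k l] by auto
  qed simp
qed

text \<open>The smallest eigenvalue on zero-mean vectors is positive because a zero-mean vector in the kernel
  would be a consensus vector.\<close>

lemma laplacian_gap_eigenvalue:
  fixes A :: "real^'n^'n"
  assumes A: "weighted_graph A" "graph_connected A" and card: "CARD('n) \<ge> 2"
  obtains \<mu> where "\<mu> \<in> eigenvalues (laplacian A)" "0 < \<mu>"
    "\<And>y :: real^'p^'n. y \<in> zero_mean \<Longrightarrow> \<mu> * (norm y)\<^sup>2 \<le> y \<bullet> block_mult (laplacian A) y"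
proof -
  let ?T = "block_mult (laplacian A) :: real^'p^'n \<Rightarrow> _"
  obtain i j :: 'n where ij: "i \<noteq> j"
    using card by (metis One_nat_def card_le_Suc0_iff_eq finite_class.finite_UNIV
        not_less_eq_eq numeral_2_eq_2 UNIV_I)
  (* This vector witnesses that there is a nonzero zero-mean vector; it takes two vertices. *)
  define d where "d = (axis i 1 - axis j 1 :: real^'p^'n)"
  have "d \<in> zero_mean" by (simp add: d_def zero_mean_def axis_def sum_subtractf)
  moreover have "d \<noteq> 0" using ij by (auto simp: d_def vec_eq_iff axis_def intro!: exI[of _ i])
  ultimately have ne: "(zero_mean :: (real^'p^'n) set) \<noteq> {0}" by auto
  have TS: "?T ` zero_mean \<subseteq> zero_mean"
    using block_mult_laplacian_zero_mean[OF A(1)] by (rule image_subsetI)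
  obtain \<mu> v where v: "v \<in> zero_mean" "v \<noteq> 0" "?T v = \<mu> *\<^sub>R v"
    and le: "\<And>x. x \<in> zero_mean \<Longrightarrow> \<mu> * (norm x)\<^sup>2 \<le> x \<bullet> ?T x"
    by (rule self_adjoint_min_eigenvector[OF linear_block_mult
        block_mult_self_adjoint[OF laplacian_symmetric[OF A(1)]] subspace_zero_mean TS ne])
      (rule that)
  have q: "v \<bullet> ?T v = \<mu> * (norm v)\<^sup>2" using v(3) by (simp add: power2_norm_eq_inner)
  have "0 \<le> v \<bullet> ?T v"
    unfolding laplacian_quadratic_form[OF A(1)] using A(1)
    by (intro divide_nonneg_pos sum_nonneg mult_nonneg_nonneg) (auto simp: weighted_graph_def)
  moreover have "v \<bullet> ?T v \<noteq> 0"
  proof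
    assume "v \<bullet> ?T v = 0"
    from laplacian_kernel[OF A this] have c: "v $ k = v $ i" for k .
    have "(\<Sum>k\<in>UNIV. v $ k) = 0" using v(1) by (simp add: zero_mean_def)
    then have "real CARD('n) *\<^sub>R v $ i = 0"
      by (subst (asm) c) (simp add: sum_constant_scaleR del: sum_constant)
    then have "v $ k = 0" for k using c[of k] by simp
    then show False using v(2) by (simp add: vec_eq_iff)
  qed
  ultimately have "0 < \<mu> * (norm v)\<^sup>2" using q by linarith
  then have "0 < \<mu>" by (simp add: zero_less_mult_iff)
  with block_mult_eigenvector(1)[OF v(2,3)] show thesis using le by (rule that)
qed

lemma finite_positive_eigenvalues: "finite {\<mu> \<in> eigenvalues M. 0 < \<mu>}" for M :: "real^'n^'n"
  by (rule finite_subset[OF _ finite_eigenvalues[of M]]) auto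

lemma rho2_laplacian_pos:
  fixes A :: "real^'n^'n"
  assumes "weighted_graph A" "graph_connected A" "CARD('n) \<ge> 2"
  shows "0 < rho2 (laplacian A)"
proof -
  obtain \<mu> where "\<mu> \<in> eigenvalues (laplacian A)" "0 < \<mu>"
    (* rho2 does not depend on the block dimension; any choice serves. *)
    by (rule laplacian_gap_eigenvalue[where ?'p = 'n, OF assms]) (rule that)
  then have "{\<mu> \<in> eigenvalues (laplacian A). 0 < \<mu>} \<noteq> {}" by blast
  from Min_in[OF finite_positive_eigenvalues this] show ?thesis by (simp add: rho2_def)
qed

text \<open>The smallest eigenvalue \<open>\<mu>\<close> on zero-mean vectors is positive, hence one of the candidates over which
  \<open>rho2\<close> takes the minimum.\<close>

lemma rho2_le_quadratic_form:
  fixes A :: "real^'n^'n" and y :: "real^'p^'n"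
  assumes A: "weighted_graph A" "graph_connected A" "CARD('n) \<ge> 2" and y: "y \<in> zero_mean"
  shows "rho2 (laplacian A) * (norm y)\<^sup>2 \<le> y \<bullet> block_mult (laplacian A) y"
proof -
  obtain \<mu> where \<mu>: "\<mu> \<in> eigenvalues (laplacian A)" "0 < \<mu>"
    "\<And>y :: real^'p^'n. y \<in> zero_mean \<Longrightarrow> \<mu> * (norm y)\<^sup>2 \<le> y \<bullet> block_mult (laplacian A) y"
    by (rule laplacian_gap_eigenvalue[OF A]) (rule that)
  have "rho2 (laplacian A) \<le> \<mu>"
    unfolding rho2_def using \<mu>(1,2) by (intro Min_le finite_positive_eigenvalues) auto
  then have "rho2 (laplacian A) * (norm y)\<^sup>2 \<le> \<mu> * (norm y)\<^sup>2" by (intro mult_right_mono) auto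
  then show ?thesis using \<mu>(3)[OF y] by linarith
qed

section \<open>Gradients and minimizers\<close>

lemma gradient_eqI: "GDERIV f x :> D \<Longrightarrow> gradient f x = D"
proof -
  assume D: "GDERIV f x :> D"
  have "D' = D" if "GDERIV f x :> D'" for D'
  proof -
    have "(\<lambda>h. h \<bullet> D') = (\<lambda>h. h \<bullet> D)"
      using that D unfolding gderiv_def by (rule has_derivative_unique)
    then show ?thesis by (metis vector_eq_ldot)
  qed
  with D show ?thesis unfolding gradient_def by blast
qed

text \<open>The gradient exists by the Riesz representation of the derivative.\<close>

lemma GDERIV_gradient:
  fixes f :: "'a::euclidean_space \<Rightarrow> real"
  assumes "f differentiable (at x)"
  shows "GDERIV f x :> gradient f x"
proof -
  obtain f' where f': "(f has_derivative f') (at x)" using assms by (auto simp: differentiable_def)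
  have "f' = (\<lambda>h. h \<bullet> adjoint f' 1)"
    using adjoint_works[OF has_derivative_linear[OF f'], of _ 1] by (simp add: fun_eq_iff)
  with f' have "GDERIV f x :> adjoint f' 1"
    unfolding gderiv_def by metis
  then show ?thesis using gradient_eqI by metis
qed

lemma gradient_at_global_minimizer:
  fixes f :: "'a::euclidean_space \<Rightarrow> real"
  assumes "f differentiable (at x)" "x \<in> global_minimizers f"
  shows "gradient f x = 0"
proof -
  have "(\<lambda>h. h \<bullet> gradient f x) = (\<lambda>h. 0)"
    using differential_zero_maxmin[of x UNIV f] GDERIV_gradient[OF assms(1)] assms(2)
    by (auto simp: gderiv_def global_minimizers_def)
  from fun_cong[OF this, of "gradient f x"] show ?thesis by simp
qed

lemma gradient_sum:
  fixes f :: "'i \<Rightarrow> 'a::euclidean_space \<Rightarrow> real"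
  assumes "\<And>i. i \<in> I \<Longrightarrow> f i differentiable (at x)"
  shows "gradient (\<lambda>y. \<Sum>i\<in>I. f i y) x = (\<Sum>i\<in>I. gradient (f i) x)"
  using GDERIV_gradient[OF assms] by (intro gradient_eqI) (simp add: gderiv_def inner_sum_right)

lemma gradient_blockwise_sum:
  fixes f :: "'n::finite \<Rightarrow> real^'p \<Rightarrow> real"
  assumes "\<And>i y. f i differentiable (at y)"
  shows "gradient (\<lambda>y. \<Sum>i\<in>UNIV. f i (y $ i)) x = (\<chi> i. gradient (f i) (x $ i))"
proof (rule gradient_eqI)
  have "((\<lambda>y. f i (y $ i)) has_derivative (\<lambda>h. h $ i \<bullet> gradient (f i) (x $ i))) (at x)" for i
    using GDERIV_gradient[OF assms, of i "x $ i"] unfolding gderiv_def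
    by (rule has_derivative_compose[OF bounded_linear_imp_has_derivative[OF bounded_linear_vec_nth]])
  then have "((\<lambda>y. \<Sum>i\<in>UNIV. f i (y $ i)) has_derivative
      (\<lambda>h. \<Sum>i\<in>UNIV. h $ i \<bullet> gradient (f i) (x $ i))) (at x)"
    by (intro has_derivative_sum)
  then show "GDERIV (\<lambda>y. \<Sum>i\<in>UNIV. f i (y $ i)) x :> (\<chi> i. gradient (f i) (x $ i))"
    by (simp add: gderiv_def inner_blocks)
qed

lemma closed_global_minimizers:
  fixes f :: "'a::topological_space \<Rightarrow> real"
  assumes "continuous_on UNIV f"
  shows "closed (global_minimizers f)"
proof -
  have "global_minimizers f = (\<Inter>y. {x. f x \<le> f y})" by (auto simp: global_minimizers_def)
  also have "closed \<dots>" by (intro closed_INT ballI closed_Collect_le assms continuous_on_const)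
  finally show ?thesis .
qed

section \<open>Stacked vectors and the consensus set\<close>

lemma has_vector_derivative_blocksI:
  fixes x :: "real \<Rightarrow> real^'p^'n"
  assumes "\<And>i. ((\<lambda>s. x s $ i) has_vector_derivative x' $ i) (at t within S)"
  shows "(x has_vector_derivative x') (at t within S)"
  unfolding has_vector_derivative_def
proof (subst has_derivative_componentwise_within, rule ballI)
  fix b :: "real^'p^'n" assume "b \<in> Basis"
  then obtain i u where b: "b = axis i u" by (auto simp: Basis_vec_def)
  show "((\<lambda>s. x s \<bullet> b) has_derivative (\<lambda>s. (s *\<^sub>R x') \<bullet> b)) (at t within S)"
    using bounded_linear.has_derivative[OF bounded_linear_inner_left assms[of i, unfolded has_vector_derivative_def], of u]
    by (simp add: b inner_axis)
qed

definition block_mean :: "real^'p^'n \<Rightarrow> real^'p" where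
  "block_mean x = (\<Sum>i\<in>UNIV. x $ i) /\<^sub>R real CARD('n)"

lemma norm_consensus: "(norm ((\<chi> i. s) :: real^'p^'n))\<^sup>2 = real CARD('n) * (norm s)\<^sup>2"
  by (simp add: power2_norm_eq_inner inner_blocks)

lemma minus_block_mean_zero_mean: "x - (\<chi> i. block_mean x) \<in> zero_mean" for x :: "real^'p^'n"
  by (simp add: zero_mean_def block_mean_def sum_subtractf sum_constant_scaleR del: sum_constant)

lemma consensus_set_closed_convex:
  fixes X :: "(real^'p) set"
  assumes "closed X" "convex X" "X \<noteq> {}"
  shows "closed (consensus_set X :: (real^'p^'n) set)" "convex (consensus_set X :: (real^'p^'n) set)"
    "consensus_set X \<noteq> ({} :: (real^'p^'n) set)"
proof -
  let ?c = "\<lambda>s. (\<chi> i. s) :: real^'p^'n"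
  have lin: "linear ?c" by (rule linearI) (simp_all add: vec_eq_iff)
  have eq: "consensus_set X = ?c ` X" by (auto simp: consensus_set_def)
  have "inj ?c" by (rule injI) (simp add: vec_eq_iff)
  then show "closed (consensus_set X :: (real^'p^'n) set)"
    using closed_injective_linear_image[OF assms(1) lin] by (simp add: eq)
  show "convex (consensus_set X :: (real^'p^'n) set)"
    unfolding eq using lin assms(2) by (rule convex_linear_image)
  show "consensus_set X \<noteq> ({} :: (real^'p^'n) set)" using assms(3) by (simp add: eq)
qed

text \<open>By Pythagoras, the squared distance from \<open>x\<close> to a consensus vector is a constant plus \<open>n\<close> times the
  squared distance from the block mean of \<open>x\<close>; minimize the latter.\<close>

lemma closest_point_consensus_set:
  fixes X :: "(real^'p) set" and x :: "real^'p^'n"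
  assumes X: "closed X" "convex X" "X \<noteq> {}"
  shows "closest_point (consensus_set X) x = (\<chi> i. closest_point X (block_mean x))"
proof (rule closest_point_unique[symmetric])
  let ?m = "block_mean x"
  have pythagoras: "(norm (x - (\<chi> i. s)))\<^sup>2
      = (norm (x - (\<chi> i. ?m)))\<^sup>2 + real CARD('n) * (norm (?m - s))\<^sup>2" for s
  proof -
    have "(\<chi> i. ?m - s) \<bullet> (x - (\<chi> i. ?m)) = 0"
      by (rule consensus_orthogonal_zero_mean[OF minus_block_mean_zero_mean])
    then have "(norm ((\<chi> i. ?m - s) + (x - (\<chi> i. ?m))))\<^sup>2
        = (norm ((\<chi> i. ?m - s) :: real^'p^'n))\<^sup>2 + (norm (x - (\<chi> i. ?m)))\<^sup>2"
      by (intro norm_add_Pythagorean) (simp add: orthogonal_def)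
    moreover have "(\<chi> i. ?m - s) + (x - (\<chi> i. ?m)) = x - (\<chi> i. s)" by (simp add: vec_eq_iff)
    ultimately show ?thesis unfolding norm_consensus by simp
  qed
  show "convex (consensus_set X :: (real^'p^'n) set)" "closed (consensus_set X :: (real^'p^'n) set)"
    using consensus_set_closed_convex[OF X] by auto
  show "(\<chi> i. closest_point X ?m) \<in> consensus_set X"
    using closest_point_in_set[OF X(1,3)] by (auto simp: consensus_set_def)
  show "\<forall>z\<in>consensus_set X. dist x (\<chi> i. closest_point X ?m) \<le> dist x z"
  proof
    fix z :: "real^'p^'n" assume "z \<in> consensus_set X"
    then obtain s where s: "z = (\<chi> i. s)" "s \<in> X" by (auto simp: consensus_set_def)
    have "norm (?m - closest_point X ?m) \<le> norm (?m - s)"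
      using closest_point_le[OF X(1) s(2), of ?m] by (simp add: dist_norm)
    then have "real CARD('n) * (norm (?m - closest_point X ?m))\<^sup>2 \<le> real CARD('n) * (norm (?m - s))\<^sup>2"
      by (intro mult_left_mono power_mono) auto
    then have "(norm (x - (\<chi> i. closest_point X ?m)))\<^sup>2 \<le> (norm (x - z))\<^sup>2"
      using pythagoras[of "closest_point X ?m"] pythagoras[of s] unfolding s(1) by linarith
    then show "dist x (\<chi> i. closest_point X ?m) \<le> dist x z"
      unfolding dist_norm by (rule power2_le_imp_le) auto
  qed
qed

lemma norm_blocks_le:
  fixes a b :: "real^'p^'n"
  assumes "\<And>i. norm (a $ i) \<le> l * norm (b $ i)" "0 \<le> l"
  shows "norm a \<le> l * norm b"
proof -
  have "norm a \<le> norm (l *\<^sub>R b)"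
    unfolding norm_vec_def[of a] norm_vec_def[of "l *\<^sub>R b"]
    by (rule L2_set_mono) (use assms in auto)
  then show ?thesis using assms(2) by simp
qed

section \<open>Coercivity and exponential convergence\<close>

text \<open>The part of coercivity that concerns the gradients.  Here \<open>a\<close> is the change of the gradient across
  the disagreement \<open>z\<close> and \<open>b\<close> its change across the consensus error \<open>u\<close>; only \<open>u \<bullet> b\<close> has a
  sign, and the two products of mixed type cost half of it by Young's inequality.\<close>

lemma orthogonal_split_lower_bound:
  fixes a b u z :: "'a::real_inner"
  assumes \<kappa>: "0 < \<kappa>" and a: "norm a \<le> l * norm z" and b: "norm b \<le> l * norm u"
    and secant: "\<kappa> * (norm u)\<^sup>2 \<le> u \<bullet> b"
  shows "\<kappa> / 2 * (norm u)\<^sup>2 - (2 * l\<^sup>2 / \<kappa> + l) * (norm z)\<^sup>2 \<le> (u + z) \<bullet> (a + b)"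
proof -
  have cs: "- (norm p * (l * norm r)) \<le> p \<bullet> q" if "norm q \<le> l * norm r" for p q r :: 'a
  proof -
    have "- (p \<bullet> q) \<le> norm p * norm q" using norm_cauchy_schwarz[of "- p" q] by simp
    also have "\<dots> \<le> norm p * (l * norm r)" using that by (intro mult_left_mono) auto
    finally show ?thesis by linarith
  qed
  (* Young's inequality, with the square chosen so that exactly half of \<kappa> is spent. *)
  have "0 \<le> (\<kappa> * norm u - 2 * l * norm z)\<^sup>2 / (2 * \<kappa>)" using \<kappa> by simp
  also have "\<dots> = \<kappa> / 2 * (norm u)\<^sup>2 + 2 * l\<^sup>2 / \<kappa> * (norm z)\<^sup>2 - 2 * l * (norm u * norm z)"
    using \<kappa> by (simp add: power2_eq_square field_simps)
  finally have young: "2 * l * (norm u * norm z) \<le> \<kappa> / 2 * (norm u)\<^sup>2 + 2 * l\<^sup>2 / \<kappa> * (norm z)\<^sup>2"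
    by linarith
  have "(u + z) \<bullet> (a + b) = u \<bullet> a + u \<bullet> b + z \<bullet> a + z \<bullet> b"
    by (simp add: inner_add_left inner_add_right)
  moreover have "- (l * (norm u * norm z)) \<le> u \<bullet> a" "- (l * (norm z)\<^sup>2) \<le> z \<bullet> a" "- (l * (norm u * norm z)) \<le> z \<bullet> b"
    using cs[OF a, of u] cs[OF a, of z] cs[OF b, of z]
    by (simp_all add: power2_eq_square mult.assoc mult.commute mult.left_commute)
  ultimately show ?thesis using young secant by (simp add: algebra_simps)
qed

text \<open>With \<open>m\<close> the block mean of \<open>y\<close> and \<open>s\<close> its projection to \<open>X\<close>, pass from \<open>y\<close> to its projection in two
  steps, through the consensus vector of \<open>m\<close>.  The error splits orthogonally as \<open>u + z\<close>; the
  secant inequality for \<open>f\<close> at \<open>m\<close> bounds the second step along \<open>u\<close>, with the factor \<open>1 / n\<close>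
  because \<open>u\<close> consists of \<open>n\<close> copies of \<open>m - s\<close>.\<close>

lemma consensus_error_coercivity:
  fixes fi :: "'n::finite \<Rightarrow> real^'p \<Rightarrow> real" and y :: "real^'p^'n"
  defines "f \<equiv> \<lambda>y. \<Sum>i\<in>UNIV. fi i y"
  defines "X \<equiv> global_minimizers f"
  defines "G \<equiv> \<lambda>y :: real^'p^'n. (\<chi> i. gradient (fi i) (y $ i)) :: real^'p^'n"
  defines "e \<equiv> y - closest_point (consensus_set X) y"
  assumes A: "weighted_graph A" "graph_connected A" "CARD('n) \<ge> 2"
    and diff: "\<And>i y. fi i differentiable (at y)"
    and X: "closed X" "convex X" "X \<noteq> {}"
    and lip: "\<And>i a b. norm (gradient (fi i) a - gradient (fi i) b) \<le> l * norm (a - b)" "0 \<le> l"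
    and \<nu>: "0 < \<nu>" and rsi: "restricted_secant_inequality f \<nu>" and \<alpha>: "0 \<le> \<alpha>"
    and c: "c \<le> \<nu> / (2 * real CARD('n))"
      "c \<le> \<alpha> * rho2 (laplacian A) - (2 * real CARD('n) * l\<^sup>2 / \<nu> + l)"
  shows "c * (norm e)\<^sup>2 \<le> \<alpha> * (e \<bullet> block_mult (laplacian A) e)
      + e \<bullet> (G y - G (closest_point (consensus_set X) y))"
proof -
  let ?n = "real CARD('n)" and ?L = "block_mult (laplacian A) :: real^'p^'n \<Rightarrow> _"
  have n: "0 < ?n" by simp
  define m where "m = block_mean y"
  define s where "s = closest_point X m"
  define u :: "real^'p^'n" where "u = (\<chi> i. m - s)"
  define z where "z = y - (\<chi> i. m)"
  have P: "closest_point (consensus_set X) y = (\<chi> i. s)"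
    unfolding s_def m_def by (rule closest_point_consensus_set[OF X])
  have e: "e = u + z" by (simp add: e_def P u_def z_def vec_eq_iff)
  have z: "z \<in> zero_mean" unfolding z_def m_def by (rule minus_block_mean_zero_mean)
  have uz: "u \<bullet> z = 0" unfolding u_def by (rule consensus_orthogonal_zero_mean[OF z])
  have norm_e: "(norm e)\<^sup>2 = (norm u)\<^sup>2 + (norm z)\<^sup>2"
    unfolding e using uz by (intro norm_add_Pythagorean) (simp add: orthogonal_def)
  have "?L u = 0" by (simp add: vec_eq_iff block_mult_laplacian u_def)
  then have "?L e = ?L z" by (simp add: e linear_add[OF linear_block_mult])
  then have "e \<bullet> ?L e = z \<bullet> ?L z"
    using consensus_orthogonal_zero_mean[OF block_mult_laplacian_zero_mean[OF A(1)], of "m - s" z]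
    by (simp add: e u_def inner_add_left)
  then have Le: "\<alpha> * (rho2 (laplacian A) * (norm z)\<^sup>2) \<le> \<alpha> * (e \<bullet> ?L e)"
    using rho2_le_quadratic_form[OF A z] \<alpha> by (intro mult_left_mono) auto
  have gf: "gradient f a = (\<Sum>i\<in>UNIV. gradient (fi i) a)" for a
    unfolding f_def using diff by (rule gradient_sum)
  have "\<nu> / ?n * (norm u)\<^sup>2 = \<nu> * (norm (m - s))\<^sup>2" by (simp add: u_def norm_consensus)
  also have "\<dots> \<le> (gradient f m - gradient f s) \<bullet> (m - s)"
    using rsi by (simp add: restricted_secant_inequality_def Let_def s_def X_def)
  also have "\<dots> = u \<bullet> (G (\<chi> i. m) - G (\<chi> i. s))"
    by (simp add: gf u_def G_def inner_blocks inner_commute inner_diff_right inner_sum_left inner_sum_right sum_subtractf)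
  finally have secant: "\<nu> / ?n * (norm u)\<^sup>2 \<le> u \<bullet> (G (\<chi> i. m) - G (\<chi> i. s))" .
  have G_lip: "norm (G a - G b) \<le> l * norm (a - b)" for a b
    using lip by (intro norm_blocks_le) (simp_all add: G_def)
  have "norm (G y - G (\<chi> i. m)) \<le> l * norm z" using G_lip by (simp add: z_def)
  moreover have "norm (G (\<chi> i. m) - G (\<chi> i. s)) \<le> l * norm u"
  proof -
    have "u = (\<chi> i. m) - (\<chi> i. s)" by (simp add: u_def vec_eq_iff)
    then show ?thesis using G_lip by simp
  qed
  ultimately have "\<nu> / ?n / 2 * (norm u)\<^sup>2 - (2 * l\<^sup>2 / (\<nu> / ?n) + l) * (norm z)\<^sup>2
      \<le> (u + z) \<bullet> ((G y - G (\<chi> i. m)) + (G (\<chi> i. m) - G (\<chi> i. s)))"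
    using \<nu> secant by (intro orthogonal_split_lower_bound) auto
  then have "\<nu> / (2 * ?n) * (norm u)\<^sup>2 - (2 * ?n * l\<^sup>2 / \<nu> + l) * (norm z)\<^sup>2
      \<le> e \<bullet> (G y - G (closest_point (consensus_set X) y))"
    by (simp add: e P mult.commute mult.left_commute)
  moreover have "c * (norm u)\<^sup>2 \<le> \<nu> / (2 * ?n) * (norm u)\<^sup>2"
    by (rule mult_right_mono[OF c(1)]) simp
  moreover have "c * (norm z)\<^sup>2 \<le> (\<alpha> * rho2 (laplacian A) - (2 * ?n * l\<^sup>2 / \<nu> + l)) * (norm z)\<^sup>2"
    by (rule mult_right_mono[OF c(2)]) simp
  ultimately show ?thesis using Le by (simp add: norm_e algebra_simps)
qed

theorem theorem1:
  fixes A :: "real^'n^'n"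
    and fi :: "'n \<Rightarrow> real^'p \<Rightarrow> real"
    and Lfi :: "'n \<Rightarrow> real"
    and \<nu> \<alpha> \<beta> :: real
    and x v :: "real \<Rightarrow> real^'p^'n"
  defines "n \<equiv> real CARD('n)"
  defines "L \<equiv> laplacian A"
  defines "f \<equiv> (\<lambda>y. \<Sum>i\<in>UNIV. fi i y)"
  defines "ft \<equiv> (\<lambda>y :: real^'p^'n. \<Sum>i\<in>UNIV. fi i (y $ i))"
  defines "X \<equiv> global_minimizers f"
  defines "XX \<equiv> (consensus_set X :: (real^'p^'n) set)"
  defines "Lf \<equiv> Max (range Lfi)"
  defines "\<nu>1 \<equiv> min (\<nu> / (2 * n)) (\<alpha> * rho2 L - (2 * n * Lf\<^sup>2 + \<nu> * Lf) / \<nu>)"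
  defines "\<epsilon>1 \<equiv> max (1 / \<nu>1 * (Lf\<^sup>2 / (2 * \<beta>) + rho L * \<beta>)) (\<beta> / \<alpha>)"
  defines "\<epsilon>2 \<equiv> min (\<beta> / 2) (\<epsilon>1 * \<nu>1)"
  defines "\<epsilon>3 \<equiv> max (\<epsilon>1 / rho2 L + \<alpha> / (2 * \<beta>) + 1 / 2) (\<epsilon>1 + 1 / 2)"
  assumes card: "CARD('n) \<ge> 2"
    and graph: "weighted_graph A" "graph_connected A"
    and diff: "\<And>i y. fi i differentiable (at y)"
    and minimizers: "X \<noteq> {}" "convex X"
    and Lfi_pos: "\<And>i. Lfi i > 0"
    and lipschitz: "\<And>i a b. norm (gradient (fi i) a - gradient (fi i) b) \<le> Lfi i * norm (a - b)"
    and nu_pos: "\<nu> > 0"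
    and rsi: "restricted_secant_inequality f \<nu>"
    and singleton: "is_singleton (gradient ft ` XX)"
    and alpha: "\<alpha> > (2 * n * Lf\<^sup>2 + \<nu> * Lf) / (\<nu> * rho2 L)"
    and beta: "\<beta> > 0"
    and sol: "solves_dynamics fi L \<alpha> \<beta> x v"
    and init: "v 0 = 0"
  shows "\<epsilon>2 > 0 \<and> \<epsilon>2 / (2 * \<epsilon>3) > 0 \<and>
    (\<exists>C\<ge>0. \<forall>t\<ge>0. norm (x t - closest_point XX (x t)) \<le> C * exp (- (\<epsilon>2 / (2 * \<epsilon>3)) * t))"
proof -
  let ?G = "\<lambda>y :: real^'p^'n. (\<chi> i. gradient (fi i) (y $ i)) :: real^'p^'n"
  have n_pos: "0 < n" by (simp add: n_def)
  have r: "0 < rho2 L" unfolding L_def by (rule rho2_laplacian_pos[OF graph card])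
  have Lf: "Lfi i \<le> Lf" for i unfolding Lf_def by (rule Max_ge) auto
  then have Lf_pos: "0 < Lf" using Lfi_pos by (metis less_le_trans)
  have lip: "norm (gradient (fi i) a - gradient (fi i) b) \<le> Lf * norm (a - b)" for i a b
    using lipschitz[of i a b] mult_right_mono[OF Lf[of i] norm_ge_zero[of "a - b"]] by linarith
  have "0 < (2 * n * Lf\<^sup>2 + \<nu> * Lf) / (\<nu> * rho2 L)"
    using n_pos Lf_pos nu_pos r by (intro divide_pos_pos add_pos_pos mult_pos_pos) auto
  then have \<alpha>_pos: "0 < \<alpha>" using alpha by linarith
  have "(2 * n * Lf\<^sup>2 + \<nu> * Lf) / \<nu> < \<alpha> * rho2 L"
    using alpha r nu_pos by (simp add: field_simps)
  then have \<nu>1_pos: "0 < \<nu>1" unfolding \<nu>1_def using nu_pos n_pos by simp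
  have \<epsilon>1_ge: "\<beta> / \<alpha> \<le> \<epsilon>1" "1 / \<nu>1 * (Lf\<^sup>2 / (2 * \<beta>) + rho L * \<beta>) \<le> \<epsilon>1"
    unfolding \<epsilon>1_def by simp_all
  then have \<epsilon>1_pos: "0 < \<epsilon>1" using divide_pos_pos[OF beta \<alpha>_pos] by linarith
  have \<epsilon>1_\<nu>1: "Lf\<^sup>2 / (2 * \<beta>) + rho L * \<beta> \<le> \<epsilon>1 * \<nu>1"
    using mult_right_mono[OF \<epsilon>1_ge(2), of \<nu>1] \<nu>1_pos by simp
  have \<epsilon>2_pos: "0 < \<epsilon>2" unfolding \<epsilon>2_def using beta \<epsilon>1_pos \<nu>1_pos by simp
  have \<epsilon>2_le: "\<epsilon>2 \<le> \<beta> / 2" "\<epsilon>2 \<le> \<epsilon>1 * \<nu>1"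
    unfolding \<epsilon>2_def by simp_all
  have \<epsilon>3_ge: "\<epsilon>1 / rho2 L + \<alpha> / (2 * \<beta>) + 1 / 2 \<le> \<epsilon>3" "\<epsilon>1 + 1 / 2 \<le> \<epsilon>3"
    unfolding \<epsilon>3_def by simp_all
  then have \<epsilon>3_pos: "0 < \<epsilon>3" using \<epsilon>1_pos by linarith
  have f_diff: "f differentiable (at y)" for y
    unfolding f_def using diff by (intro differentiable_sum) auto
  then have "continuous_on UNIV f"
    by (intro continuous_at_imp_continuous_on ballI differentiable_imp_continuous_within)
  then have X: "closed X" "convex X" "X \<noteq> {}"
    using minimizers closed_global_minimizers by (auto simp: X_def)
  obtain g where g: "gradient ft ` XX = {g}" using singleton by (auto simp: is_singleton_def)
  have G: "gradient ft = ?G" unfolding ft_def using gradient_blockwise_sum[of fi] diff by (intro ext) auto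
  have Gg: "?G c = g" if "c \<in> XX" for c using g that unfolding G by blast
  obtain s where s: "s \<in> X" using X by blast
  have "(\<Sum>i\<in>UNIV. gradient (fi i) s) = gradient f s"
    unfolding f_def using diff by (intro gradient_sum[symmetric])
  also have "\<dots> = 0" using gradient_at_global_minimizer[OF f_diff] s by (simp add: X_def)
  finally have "?G (\<chi> i. s) \<in> zero_mean" by (simp add: zero_mean_def)
  moreover have "(\<chi> i. s) \<in> XX" using s unfolding XX_def consensus_set_def by blast
  ultimately have g0: "g \<in> zero_mean" using Gg by metis
  note XX = consensus_set_closed_convex[OF X, where ?'n = 'n, folded XX_def]
  have PXX: "closest_point XX y \<in> XX" for y using closest_point_in_set[OF XX(1,3)] .
  have "\<exists>K\<ge>0. \<forall>t\<ge>0. norm (x t - closest_point XX (x t)) \<le> K * exp (- (\<epsilon>2 / (2 * \<epsilon>3)) * t)"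
  proof (rule primal_dual_flow_exponential_convergence[where T = "block_mult L" and F = ?G and S = zero_mean
        and g = g and v = v and r = "rho2 L" and R = "rho L" and l = Lf and \<beta> = \<beta> and \<alpha> = \<alpha>
        and \<kappa> = \<nu>1 and \<eta> = \<epsilon>1])
    show "y \<bullet> block_mult L z = block_mult L y \<bullet> z" for y z :: "real^'p^'n"
      unfolding L_def by (rule block_mult_self_adjoint[OF laplacian_symmetric[OF graph(1)]])
    show "range (block_mult L :: real^'p^'n \<Rightarrow> _) \<subseteq> zero_mean"
      unfolding L_def using block_mult_laplacian_zero_mean[OF graph(1)] by blast
    show "rho2 L * (norm y)\<^sup>2 \<le> y \<bullet> block_mult L y" if "y \<in> zero_mean" for y :: "real^'p^'n"
      unfolding L_def by (rule rho2_le_quadratic_form[OF graph card that])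
    show "y \<bullet> block_mult L y \<le> rho L * (norm y)\<^sup>2" for y :: "real^'p^'n"
      unfolding L_def by (rule quadratic_form_le_rho[OF laplacian_symmetric[OF graph(1)]])
    show "c \<bullet> s = 0" if "c \<in> XX" "s \<in> zero_mean" for c s
      using that consensus_orthogonal_zero_mean by (auto simp: XX_def consensus_set_def)
    show "norm (?G y - g) \<le> Lf * norm (y - closest_point XX y)" for y
      unfolding Gg[OF PXX[of y], symmetric] using lip Lf_pos by (intro norm_blocks_le) simp_all
    show "\<nu>1 * (norm (y - closest_point XX y))\<^sup>2
        \<le> \<alpha> * ((y - closest_point XX y) \<bullet> block_mult L (y - closest_point XX y))
          + (y - closest_point XX y) \<bullet> (?G y - g)" for y
    proof -
      have "\<nu>1 \<le> \<nu> / (2 * real CARD('n))"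
        and "\<nu>1 \<le> \<alpha> * rho2 (laplacian A) - (2 * real CARD('n) * Lf\<^sup>2 / \<nu> + Lf)"
        unfolding \<nu>1_def n_def L_def using nu_pos by (simp_all add: add_divide_distrib)
      from consensus_error_coercivity[OF graph card diff X[unfolded X_def f_def] lip less_imp_le[OF Lf_pos] nu_pos
          rsi[unfolded f_def] less_imp_le[OF \<alpha>_pos] this, of y]
      show ?thesis
        unfolding Gg[OF PXX[of y], symmetric] by (simp only: XX_def X_def f_def L_def)
    qed
    show "(x has_vector_derivative - \<alpha> *\<^sub>R block_mult L (x t) - \<beta> *\<^sub>R v t - ?G (x t)) (at t within {0..})"
      if "0 \<le> t" for t
      using sol that by (intro has_vector_derivative_blocksI) (simp add: solves_dynamics_def block_mult_def)
    show "(v has_vector_derivative \<beta> *\<^sub>R block_mult L (x t)) (at t within {0..})" if "0 \<le> t" for t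
      using sol that by (intro has_vector_derivative_blocksI) (simp add: solves_dynamics_def block_mult_def)
    show "v 0 \<in> zero_mean" by (simp add: init zero_mean_def)
  qed (fact linear_block_mult subspace_zero_mean r XX g0 \<alpha>_pos beta \<nu>1_pos
      \<epsilon>1_ge \<epsilon>1_\<nu>1 \<epsilon>2_pos \<epsilon>2_le \<epsilon>3_ge)+
  then show ?thesis using \<epsilon>2_pos \<epsilon>3_pos by simp
qed

end
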